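(* Let $n\ge 2$ be an integer. Let $\mathfrak A$ and $\mathfrak A'$ be two $C^*$-algebras with identities $I_{\mathfrak A}$ and $I_{\mathfrak A'}$, respectively, and let $P_1$ and $P_2=I_{\mathfrak A}-P_1$ be nontrivial symmetric projections in $\mathfrak A$. Suppose that for each $j\in\{1,2\}$ and each $X\in\mathfrak A$, $P_j\mathfrak A X=\{0\}$ implies $X=0$. Suppose moreover that $\varphi:\mathfrak A\to\mathfrak A'$ is a bijective unital map (not assumed additive) that preserves complex scalar multiplication, such that for each $j\in\{1,2\}$ and each $Y\in\mathfrak A'$, $\varphi(P_j)\mathfrak A'Y=\{0\}$ implies $Y=0$, and such that $$\varphi\big(p_{n_*}(A,B,\Xi,\ldots,\Xi)\big)=p_{n_*}\big(\varphi(A),\varphi(B),\varphi(\Xi),\ldots,\varphi(\Xi)\big)$$ for all $A,B\in\mathfrak A$ and all $\Xi\in\{P_1,P_2,I_{\mathfrak A}\}$ (the same $\Xi$ in each of the last $n-2$ slots). Then $\varphi$ is a $*$-isomorphism.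
   Context: A $C^*$-algebra is a complete normed complex algebra with a conjugate-linear algebra involution $*$ satisfying $\|a^*a\|=\|a\|^2$. For elements $x,y$ of a $*$-algebra, $[x,y]_*=xy-yx^*$. The polynomials $p_{n_*}$ are defined by $p_{1_*}(x)=x$ and $p_{n_*}(x_1,\ldots,x_n)=[p_{(n-1)_*}(x_1,\ldots,x_{n-1}),x_n]_*$ for $n\ge 2$. A symmetric projection is an element $P$ with $P^2=P=P^*$; nontrivial means different from $0$ and the identity. Unital means $\varphi(I_{\mathfrak A})=I_{\mathfrak A'}$. Preserving complex scalar multiplication means $\varphi(\lambda A)=\lambda\varphi(A)$ for all $\lambda\in\mathbb C$, $A\in\mathfrak A$. A $*$-isomorphism is a bijective complex-linear multiplicative map preserving $*$. *)

theory Defs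
  imports Complex_Main
begin

(* The library has no class of complex algebras, so scaleC is added on top of the real structure
   and tied to scaleR.  Sort real_algebra_1 includes 0 ~= 1, so this is the class of nonzero unital
   C*-algebras; norm 1 = 1 is derived below, not assumed. *)
class unital_cstar_algebra = real_normed_algebra + real_algebra_1 + banach +
  fixes scaleC :: "complex \<Rightarrow> 'a \<Rightarrow> 'a"
    and star :: "'a \<Rightarrow> 'a"
  assumes scaleC_add_right: "scaleC c (x + y) = scaleC c x + scaleC c y"
    and scaleC_add_left: "scaleC (c + d) x = scaleC c x + scaleC d x"
    and scaleC_scaleC: "scaleC c (scaleC d x) = scaleC (c * d) x"
    and scaleC_one: "scaleC 1 x = x"
    and scaleR_scaleC: "scaleR r x = scaleC (complex_of_real r) x"
    and mult_scaleC_left: "scaleC c x * y = scaleC c (x * y)"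
    and mult_scaleC_right: "x * scaleC c y = scaleC c (x * y)"
    and norm_scaleC: "norm (scaleC c x) = cmod c * norm x"
    and star_add: "star (x + y) = star x + star y"
    and star_scaleC: "star (scaleC c x) = scaleC (cnj c) (star x)"
    and star_mult: "star (x * y) = star y * star x"
    and star_star: "star (star x) = x"
    and cstar_identity: "norm (star x * x) = (norm x)\<^sup>2"

lemma star_one: "star 1 = (1::'a::unital_cstar_algebra)"
  by (metis mult.left_neutral mult.right_neutral star_mult star_star)

instance unital_cstar_algebra \<subseteq> real_normed_algebra_1
proof
  have "norm (1::'a) = (norm (1::'a))\<^sup>2"
    using cstar_identity[of "1::'a"] by (simp add: star_one)
  then show "norm (1::'a) = 1"
    by (simp add: power2_eq_square)
qed

definition star_bracket :: "'a::unital_cstar_algebra \<Rightarrow> 'a \<Rightarrow> 'a" where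
  "star_bracket x y = x * y - y * star x"

(* p_star n x is p_{n*}(x 1, ..., x n); the value at n = 0 is a dummy. *)
fun p_star :: "nat \<Rightarrow> (nat \<Rightarrow> 'a::unital_cstar_algebra) \<Rightarrow> 'a" where
  "p_star 0 x = 0"
| "p_star (Suc 0) x = x 1"
| "p_star (Suc (Suc n)) x = star_bracket (p_star (Suc n) x) (x (Suc (Suc n)))"

definition symmetric_projection :: "'a::unital_cstar_algebra \<Rightarrow> bool" where
  "symmetric_projection P \<longleftrightarrow> P\<^sup>2 = P \<and> star P = P"

definition nontrivial_symmetric_projection :: "'a::unital_cstar_algebra \<Rightarrow> bool" where
  "nontrivial_symmetric_projection P \<longleftrightarrow> symmetric_projection P \<and> P \<noteq> 0 \<and> P \<noteq> 1"

definition star_isomorphism :: "('a::unital_cstar_algebra \<Rightarrow> 'b::unital_cstar_algebra) \<Rightarrow> bool" where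
  "star_isomorphism f \<longleftrightarrow> bij f \<and>
     (\<forall>x y. f (x + y) = f x + f y) \<and>
     (\<forall>c x. f (scaleC c x) = scaleC c (f x)) \<and>
     (\<forall>x y. f (x * y) = f x * f y) \<and>
     (\<forall>x. f (star x) = star (f x))"

end

theory Submission
  imports Defs
begin

text \<open>
  The information is extracted from the bracket identity with \<open>\<Xi> = 1\<close>. The operator
  \<open>x \<mapsto> [x, 1]\<^sub>* = x - x\<^sup>*\<close> doubles its own values, so after cancelling powers of two the identity
  says that \<open>\<phi>\<close> commutes with \<open>x \<mapsto> x - x\<^sup>*\<close> and preserves the skew part of \<open>[x, b]\<^sub>*\<close>; for
  selfadjoint \<open>b\<close> the bracket \<open>xb - bx\<^sup>* = xb - (xb)\<^sup>*\<close> is itself skew, so it is preserved.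

  Replacing \<open>x\<close> by \<open>ix\<close> turns these statements on skew parts into statements on selfadjoint parts.
  Adding the two gives, with no additivity assumed, that \<open>\<phi>\<close> preserves the involution
  (\<open>preserves_star\<close>) and that \<open>\<phi> (x b) = \<phi> x \<phi> b\<close> for arbitrary \<open>x\<close> and selfadjoint \<open>b\<close>
  (\<open>mult_selfadjoint\<close>).

  Additivity then follows as in Martindale's theorem on multiplicative bijections. The two projections
  are selfadjoint, so \<open>\<phi>\<close> maps Peirce components to Peirce components and is additive across them
  (\<open>sum_of_peirce_images\<close>). On an off-diagonal corner, additivity is read off from a product with a
  selfadjoint factor (\<open>additive_off_diagonal\<close>); on a diagonal corner it is obtained by multiplying
  into the off-diagonal corner, where the faithfulness hypothesis on the projections allows
  cancellation (\<open>additive_diagonal\<close>). Finally, every element is \<open>s + i t\<close> with \<open>s\<close>, \<open>t\<close> selfadjoint,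
  so additivity extends multiplicativity from selfadjoint right factors to all of them.
\<close>

section \<open>The involution and complex scalars\<close>

lemma double_eq_iff:
  fixes x y :: "'a::real_vector"
  shows "x + x = y + y \<longleftrightarrow> x = y"
  by (metis scaleR_half_double)

lemma scaleC_zero_left [simp]: "scaleC 0 x = 0"
  by (metis add_cancel_right_right scaleC_add_left)

lemma scaleC_zero_right [simp]: "scaleC c 0 = 0"
  by (metis add_cancel_right_right scaleC_add_right)

lemma scaleC_minus_left: "scaleC (- c) x = - scaleC c x"
  by (metis add_eq_0_iff add.right_inverse scaleC_add_left scaleC_zero_left)

lemma scaleC_minus_right: "scaleC c (- x) = - scaleC c x"
  by (metis add_eq_0_iff add.right_inverse scaleC_add_right scaleC_zero_right)

lemma scaleC_diff_right: "scaleC c (x - y) = scaleC c x - scaleC c y"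
  using scaleC_add_right[of c x "- y"] by (simp add: scaleC_minus_right)

lemma scaleC_cancel:
  assumes "c \<noteq> 0" "scaleC c x = scaleC c y"
  shows "x = y"
  using assms by (metis left_inverse scaleC_one scaleC_scaleC)

lemma scaleC_two: "scaleC 2 x = x + x"
  by (metis one_add_one scaleC_add_left scaleC_one)

lemma star_zero [simp]: "star 0 = 0"
  by (metis add_cancel_right_right star_add)

lemma star_minus: "star (- x) = - star x"
  by (metis add_eq_0_iff add.right_inverse star_add star_zero)

lemma star_diff: "star (x - y) = star x - star y"
  using star_add[of x "- y"] by (simp add: star_minus)

lemmas star_simps = star_add star_diff star_minus star_mult star_star star_scaleC

section \<open>Iterated brackets with the identity\<close>

lemma star_bracket_one: "star_bracket x 1 = x - star x"
  by (simp add: star_bracket_def)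

lemma p_star_identity_tail:
  "p_star (Suc (Suc k)) ((\<lambda>_. 1)(1 := A, 2 := B))
     = ((\<lambda>x. x - star x) ^^ k) (star_bracket A B)"
proof (induction k)
  case 0
  then show ?case by (simp add: numeral_2_eq_2)
next
  case (Suc k)
  have "p_star (Suc (Suc (Suc k))) ((\<lambda>_. 1)(1 := A, 2 := B))
      = star_bracket (p_star (Suc (Suc k)) ((\<lambda>_. 1)(1 := A, 2 := B))) 1"
    by simp
  then show ?case
    by (simp only: Suc.IH star_bracket_one funpow.simps o_apply)
qed

text \<open>A skew element is doubled by \<open>x \<mapsto> x - x\<^sup>*\<close>, so iterating only produces a power of two.\<close>

lemma skew_part_funpow:
  "((\<lambda>x. x - star x) ^^ k) (x - star x) = scaleC (2 ^ k) (x - star x)"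
proof (induction k)
  case 0
  then show ?case by (simp add: scaleC_one)
next
  case (Suc k)
  have "scaleC c (x - star x) - star (scaleC c (x - star x))
      = scaleC (2 * c) (x - star x)" if "cnj c = c" for c
    using that
    by (simp add: star_simps scaleC_diff_right scaleC_scaleC [symmetric] scaleC_two)
  then show ?case
    by (simp add: Suc.IH)
qed

section \<open>From skew parts to products with a selfadjoint factor\<close>

locale skew_bracket_preserver =
  fixes \<phi> :: "'a::unital_cstar_algebra \<Rightarrow> 'b::unital_cstar_algebra"
  assumes homogeneous: "\<phi> (scaleC c x) = scaleC c (\<phi> x)"
    and skew_part: "\<phi> (x - star x) = \<phi> x - star (\<phi> x)"
    and bracket: "star b = b \<Longrightarrow> \<phi> (star_bracket x b) = star_bracket (\<phi> x) (\<phi> b)"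
begin

lemma zero [simp]: "\<phi> 0 = 0"
  using homogeneous[of 0 0] by simp

lemma minus: "\<phi> (- x) = - \<phi> x"
  using homogeneous[of "-1" x] by (simp add: scaleC_minus_left scaleC_one)

text \<open>The skew part of \<open>ix\<close> is \<open>i\<close> times the selfadjoint part of \<open>x\<close>.\<close>

lemma selfadjoint_part: "\<phi> (x + star x) = \<phi> x + star (\<phi> x)"
proof -
  have "scaleC \<i> (\<phi> (x + star x)) = scaleC \<i> (\<phi> x + star (\<phi> x))"
    using skew_part[of "scaleC \<i> x"]
    by (simp add: star_simps homogeneous scaleC_minus_left flip: scaleC_add_right)
  then show ?thesis
    by (rule scaleC_cancel[rotated]) simp
qed

lemma preserves_star: "\<phi> (star x) = star (\<phi> x)"
proof -
  have "\<phi> (star x) + star (\<phi> (star x)) = \<phi> x + star (\<phi> x)"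
    using selfadjoint_part[of x] selfadjoint_part[of "star x"]
    by (simp add: star_star add.commute)
  moreover have "\<phi> (star x) - star (\<phi> (star x)) = - (\<phi> x - star (\<phi> x))"
    using skew_part[of x] skew_part[of "star x"] minus[of "x - star x"]
    by (simp add: star_star)
  ultimately have "(\<phi> (star x) + star (\<phi> (star x))) + (\<phi> (star x) - star (\<phi> (star x)))
      = (\<phi> x + star (\<phi> x)) + - (\<phi> x - star (\<phi> x))"
    by (simp only:)
  then have "\<phi> (star x) + \<phi> (star x) = star (\<phi> x) + star (\<phi> x)"
    by simp
  then show ?thesis
    by (simp add: double_eq_iff)
qed

text \<open>
  For selfadjoint \<open>b\<close> the brackets of \<open>x\<close> and \<open>ix\<close> with \<open>b\<close> are, up to scalar factors, the skew and
  the selfadjoint part of \<open>x b\<close>, and an element is determined by these two parts.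
\<close>

lemma mult_selfadjoint:
  assumes b: "star b = b"
  shows "\<phi> (x * b) = \<phi> x * \<phi> b"
proof -
  have b': "star (\<phi> b) = \<phi> b"
    using preserves_star[of b] b by simp
  have skew: "\<phi> (x * b) - star (\<phi> (x * b)) = \<phi> x * \<phi> b - \<phi> b * star (\<phi> x)"
    using bracket[OF b, of x] skew_part[of "x * b"] b
    by (simp add: star_bracket_def star_mult)
  have "scaleC \<i> (\<phi> (x * b + b * star x)) = scaleC \<i> (\<phi> x * \<phi> b + \<phi> b * star (\<phi> x))"
    using bracket[OF b, of "scaleC \<i> x"]
    by (simp add: star_bracket_def star_simps homogeneous scaleC_minus_left
        mult_scaleC_left mult_scaleC_right flip: scaleC_add_right)
  then have "\<phi> (x * b + b * star x) = \<phi> x * \<phi> b + \<phi> b * star (\<phi> x)"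
    by (rule scaleC_cancel[rotated]) simp
  then have "\<phi> (x * b) + star (\<phi> (x * b)) = \<phi> x * \<phi> b + \<phi> b * star (\<phi> x)"
    using selfadjoint_part[of "x * b"] b by (simp add: star_mult)
  with skew have "(\<phi> (x * b) - star (\<phi> (x * b))) + (\<phi> (x * b) + star (\<phi> (x * b)))
      = (\<phi> x * \<phi> b - \<phi> b * star (\<phi> x)) + (\<phi> x * \<phi> b + \<phi> b * star (\<phi> x))"
    by simp
  then have "\<phi> (x * b) + \<phi> (x * b) = \<phi> x * \<phi> b + \<phi> x * \<phi> b"
    by simp
  then show ?thesis
    by (simp add: double_eq_iff)
qed

lemma selfadjoint_mult:
  assumes b: "star b = b"
  shows "\<phi> (b * x) = \<phi> b * \<phi> x"
proof -
  have "star (\<phi> (b * x)) = star (\<phi> b * \<phi> x)"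
    using mult_selfadjoint[OF b, of "star x"] b
    by (simp add: star_mult flip: preserves_star)
  then show ?thesis
    by (metis star_star)
qed

lemma multiplicative_if_additive:
  assumes add: "\<And>x y. \<phi> (x + y) = \<phi> x + \<phi> y"
  shows "\<phi> (x * y) = \<phi> x * \<phi> y"
proof -
  have "\<phi> (x * (y + star y)) = \<phi> x * \<phi> (y + star y)"
    by (rule mult_selfadjoint) (simp add: star_simps add.commute)
  then have re: "\<phi> (x * y) + \<phi> (x * star y) = \<phi> x * \<phi> y + \<phi> x * \<phi> (star y)"
    by (simp add: add distrib_left)
  \<comment> \<open>The factor \<open>i\<close> makes \<open>y - y\<^sup>*\<close> selfadjoint.\<close>
  have "\<phi> (x * scaleC \<i> (y - star y)) = \<phi> x * \<phi> (scaleC \<i> (y - star y))"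
    by (rule mult_selfadjoint) (simp add: star_simps scaleC_minus_left flip: scaleC_minus_right)
  then have "scaleC \<i> (\<phi> (x * (y - star y))) = scaleC \<i> (\<phi> x * \<phi> (y - star y))"
    by (simp add: mult_scaleC_right homogeneous)
  then have "\<phi> (x * (y - star y)) = \<phi> x * \<phi> (y - star y)"
    by (rule scaleC_cancel[rotated]) simp
  then have im: "\<phi> (x * y) - \<phi> (x * star y) = \<phi> x * \<phi> y - \<phi> x * \<phi> (star y)"
    using add[of y "- star y"] add[of "x * y" "- (x * star y)"]
    by (simp add: minus right_diff_distrib)
  have "(\<phi> (x * y) + \<phi> (x * star y)) + (\<phi> (x * y) - \<phi> (x * star y))
      = (\<phi> x * \<phi> y + \<phi> x * \<phi> (star y)) + (\<phi> x * \<phi> y - \<phi> x * \<phi> (star y))"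
    by (simp only: re im)
  then have "\<phi> (x * y) + \<phi> (x * y) = \<phi> x * \<phi> y + \<phi> x * \<phi> y"
    by simp
  then show ?thesis
    by (simp add: double_eq_iff)
qed

end

section \<open>Additivity through the Peirce decomposition\<close>

text \<open>The assumptions are symmetric in \<open>P\<close> and \<open>R\<close>, which halves the number of corners to treat.\<close>

locale peirce_skew_bracket_preserver = skew_bracket_preserver \<phi>
  for \<phi> :: "'a::unital_cstar_algebra \<Rightarrow> 'b::unital_cstar_algebra" +
  fixes P R :: 'a
  assumes bij: "bij \<phi>"
    and unital: "\<phi> 1 = 1"
    and star_P: "star P = P" and star_R: "star R = R"
    and idem_P: "P * P = P" and idem_R: "R * R = R"
    and orth: "P * R = 0" "R * P = 0"
    and complementary: "P + R = 1"
    and faithful_P: "(\<And>a. P * a * x = 0) \<Longrightarrow> x = 0"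
    and faithful_R: "(\<And>a. R * a * x = 0) \<Longrightarrow> x = 0"
begin

lemma swapped: "peirce_skew_bracket_preserver \<phi> R P"
proof
  show "R + P = 1"
    using complementary by (simp add: add.commute)
qed (fact bij unital star_P star_R idem_P idem_R orth faithful_P faithful_R)+

lemma eq_iff: "\<phi> x = \<phi> y \<longleftrightarrow> x = y"
  using bij by (simp add: bij_def inj_eq)

lemma surjE: obtains x where "\<phi> x = y"
  using bij by (metis bij_pointE)

lemma corner_image:
  assumes "star E = E" "star F = F"
  shows "\<phi> (E * x * F) = \<phi> E * \<phi> x * \<phi> F"
  using assms by (simp add: mult_selfadjoint selfadjoint_mult)

lemma idem_image_P: "\<phi> P * \<phi> P = \<phi> P"
  using mult_selfadjoint[OF star_P, of P] by (simp add: idem_P)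

lemma orth_image: "\<phi> P * \<phi> R = 0" "\<phi> R * \<phi> P = 0"
  using mult_selfadjoint[OF star_R, of P] mult_selfadjoint[OF star_P, of R] by (simp_all add: orth)

lemma idem_image_R: "\<phi> R * \<phi> R = \<phi> R"
  using mult_selfadjoint[OF star_R, of R] by (simp add: idem_R)

text \<open>A preimage of \<open>1 - \<phi> P - \<phi> R\<close> is annihilated by \<open>P\<close> and by \<open>R\<close>, hence vanishes.\<close>

lemma complementary_image: "\<phi> P + \<phi> R = 1"
proof -
  obtain x where x: "\<phi> x = 1 - \<phi> P - \<phi> R"
    by (rule surjE)
  have "\<phi> (P * x) = \<phi> 0" "\<phi> (R * x) = \<phi> 0"
    by (simp_all add: selfadjoint_mult star_P star_R x right_diff_distrib
        idem_image_P idem_image_R orth_image)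
  then have "P * x = 0" "R * x = 0"
    by (simp_all only: eq_iff)
  then have "(P + R) * x = 0"
    by (simp add: distrib_right)
  then have "x = 0"
    by (simp add: complementary)
  then show ?thesis
    using x by (simp add: algebra_simps)
qed

text \<open>The images of the corners are the corners of the image.\<close>

lemma sum_of_peirce_images:
  "\<phi> x = \<phi> (P * x * P) + \<phi> (P * x * R) + \<phi> (R * x * P) + \<phi> (R * x * R)"
proof -
  have "\<phi> x = (\<phi> P + \<phi> R) * \<phi> x * (\<phi> P + \<phi> R)"
    by (simp add: complementary_image)
  then show ?thesis
    by (simp add: corner_image star_P star_R distrib_left distrib_right add_ac)
qed

text \<open>
  Since \<open>x y = 0\<close>, one has \<open>x + y = (P + x) (R + y)\<close>, and \<open>\<phi>\<close> is additive on both factors because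
  their summands lie in different corners. To make \<open>\<phi>\<close> multiplicative here, \<open>R + y\<close> is written
  as \<open>(R + y + y\<^sup>*) R\<close>, a product of selfadjoint elements.
\<close>

lemma additive_off_diagonal:
  assumes x: "P * x * R = x" and y: "P * y * R = y"
  shows "\<phi> (x + y) = \<phi> x + \<phi> y"
proof -
  have cx: "P * x = x" "x * R = x" "x * P = 0" "R * x = 0"
    by (metis x idem_P idem_R orth mult.assoc mult_zero_left mult_zero_right)+
  have cy: "P * y = y" "y * R = y" "y * P = 0" "R * y = 0"
    by (metis y idem_P idem_R orth mult.assoc mult_zero_left mult_zero_right)+
  have cys: "star y * R = 0"
    using arg_cong[OF cy(4), of star] by (simp add: star_mult star_R)
  define u where "u = P + x"
  define v where "v = R + y + star y"
  have sv: "star v = v"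
    by (simp add: v_def star_simps star_R algebra_simps)
  have u: "\<phi> u = \<phi> P + \<phi> x"
    by (subst sum_of_peirce_images)
      (simp add: u_def distrib_left distrib_right idem_P orth cx)
  have vR: "v * R = R + y"
    by (simp add: v_def distrib_right idem_R cy cys)
  have \<phi>vR: "\<phi> v * \<phi> R = \<phi> R + \<phi> y"
    unfolding mult_selfadjoint[OF star_R, symmetric] vR
    by (subst sum_of_peirce_images) (simp add: distrib_left distrib_right idem_R orth cy)
  have "x * y = 0"
    by (metis cx(2) cy(4) mult.assoc mult_zero_right)
  then have "x + y = u * v * R"
    by (simp add: mult.assoc vR) (simp add: u_def distrib_left distrib_right orth cx cy)
  then have "\<phi> (x + y) = \<phi> u * (\<phi> v * \<phi> R)"
    by (simp only: mult_selfadjoint[OF sv] mult_selfadjoint[OF star_R]) (simp only: mult.assoc)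
  also have "\<dots> = \<phi> P * \<phi> y + \<phi> x * \<phi> R + \<phi> x * \<phi> y"
    by (simp add: u \<phi>vR distrib_left distrib_right orth_image)
  also have "\<phi> P * \<phi> y = \<phi> y"
    by (simp add: cy flip: selfadjoint_mult[OF star_P])
  also have "\<phi> x * \<phi> R = \<phi> x"
    by (simp add: cx flip: mult_selfadjoint[OF star_R])
  also have "\<phi> x * \<phi> y = 0"
  proof -
    have "\<phi> x * \<phi> y = \<phi> (x * R) * \<phi> y"
      by (simp add: cx)
    also have "\<dots> = \<phi> x * \<phi> (R * y)"
      by (simp only: mult_selfadjoint[OF star_R] selfadjoint_mult[OF star_R] mult.assoc)
    finally show ?thesis
      by (simp add: cy)
  qed
  finally show ?thesis
    by (simp add: add.commute)
qed

text \<open>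
  Let \<open>u\<close> be the preimage of \<open>\<phi> x + \<phi> y\<close>. Multiplying by a selfadjoint \<open>c + c\<^sup>*\<close> with \<open>c\<close> in the
  \<open>(P, R)\<close>-corner moves the question to that corner, where additivity is known, and shows that
  \<open>u - x - y\<close> annihilates the whole corner from the left; faithfulness of \<open>R\<close> makes it zero.
\<close>

lemma additive_diagonal:
  assumes x: "P * x * P = x" and y: "P * y * P = y"
  shows "\<phi> (x + y) = \<phi> x + \<phi> y"
proof -
  obtain u where u: "\<phi> u = \<phi> x + \<phi> y"
    by (rule surjE)
  have cx: "P * x = x" "x * P = x" "x * R = 0"
    by (metis x idem_P orth mult.assoc mult_zero_right)+
  have cy: "P * y = y" "y * P = y" "y * R = 0"
    by (metis y idem_P orth mult.assoc mult_zero_right)+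
  have "\<phi> (u * P) = \<phi> u"
    by (simp add: mult_selfadjoint star_P u distrib_right
        mult_selfadjoint[OF star_P, symmetric] cx cy)
  then have uP: "u * P = u"
    by (simp only: eq_iff)
  then have uR: "u * R = 0"
    by (metis mult.assoc mult_zero_right orth(1))
  define w where "w = u - (x + y)"
  have "w * (P * a * R) = 0" for a
  proof -
    define c where "c = P * a * R + star (P * a * R)"
    have sc: "star c = c"
      by (simp add: c_def star_add star_star add.commute)
    have absorb: "z * c = z * (P * a * R)" if "z * R = 0" for z
      using that by (simp add: c_def distrib_left star_mult star_P star_R mult.assoc[symmetric])
    have corner: "P * (z * (P * a * R)) * R = z * (P * a * R)" if "P * z = z" for z
      by (metis that idem_R mult.assoc)
    have "\<phi> (u * c) = \<phi> (x * c) + \<phi> (y * c)"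
      by (simp add: mult_selfadjoint[OF sc] u distrib_right)
    then have "\<phi> (u * (P * a * R)) = \<phi> (x * (P * a * R)) + \<phi> (y * (P * a * R))"
      by (simp add: absorb uR cx cy)
    also have "\<dots> = \<phi> (x * (P * a * R) + y * (P * a * R))"
      by (intro additive_off_diagonal[symmetric] corner cx cy)
    finally have "u * (P * a * R) = x * (P * a * R) + y * (P * a * R)"
      by (simp only: eq_iff)
    then show ?thesis
      by (simp add: w_def left_diff_distrib distrib_right)
  qed
  moreover have "w * P = w"
    by (simp add: w_def left_diff_distrib distrib_right uP cx cy)
  ultimately have ann: "w * a * R = 0" for a
    by (metis mult.assoc)
  have "star w = 0"
  proof (rule faithful_R)
    fix a
    have "star (w * star a * R) = 0"
      by (simp add: ann)
    then show "R * a * star w = 0"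
      by (simp add: star_simps star_R mult.assoc)
  qed
  then have "w = 0"
    by (metis star_star star_zero)
  then show ?thesis
    using u by (simp add: w_def)
qed

lemma additive: "\<phi> (x + y) = \<phi> x + \<phi> y"
proof -
  interpret swap: peirce_skew_bracket_preserver \<phi> R P
    by (rule swapped)
  have corner: "E * (E * z * F) * F = E * z * F" if "E * E = E" "F * F = F" for E F z :: 'a
    using that by (metis mult.assoc)
  have split: "E * (x + y) * F = E * x * F + E * y * F" for E F
    by (simp add: distrib_left distrib_right)
  have "\<phi> (P * (x + y) * P) = \<phi> (P * x * P) + \<phi> (P * y * P)"
    unfolding split by (intro additive_diagonal corner idem_P)
  moreover have "\<phi> (P * (x + y) * R) = \<phi> (P * x * R) + \<phi> (P * y * R)"
    unfolding split by (intro additive_off_diagonal corner idem_P idem_R)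
  moreover have "\<phi> (R * (x + y) * P) = \<phi> (R * x * P) + \<phi> (R * y * P)"
    unfolding split by (intro swap.additive_off_diagonal corner idem_P idem_R)
  moreover have "\<phi> (R * (x + y) * R) = \<phi> (R * x * R) + \<phi> (R * y * R)"
    unfolding split by (intro swap.additive_diagonal corner idem_R)
  ultimately show ?thesis
    by (simp add: sum_of_peirce_images[of "x + y"] sum_of_peirce_images[of x]
        sum_of_peirce_images[of y] algebra_simps)
qed

lemma star_isomorphism: "star_isomorphism \<phi>"
  unfolding star_isomorphism_def
  using bij additive homogeneous multiplicative_if_additive[OF additive] preserves_star by blast

end

section \<open>Maps preserving the iterated bracket\<close>

text \<open>
  With \<open>B = 1\<close> the iterated bracket is a multiple of \<open>A - A\<^sup>*\<close>, which settles skew parts. For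
  selfadjoint \<open>B\<close> the bracket \<open>[A, B]\<^sub>*\<close> is skew, so the iterated bracket is a multiple of it.
\<close>

lemma skew_bracket_preserver_if_p_star:
  fixes \<phi> :: "'a::unital_cstar_algebra \<Rightarrow> 'b::unital_cstar_algebra"
  assumes n: "n \<ge> 2"
    and one: "\<phi> 1 = 1"
    and hom: "\<And>c A. \<phi> (scaleC c A) = scaleC c (\<phi> A)"
    and p: "\<And>A B. \<phi> (p_star n ((\<lambda>_. 1)(1 := A, 2 := B)))
              = p_star n ((\<lambda>_. 1)(1 := \<phi> A, 2 := \<phi> B))"
  shows "skew_bracket_preserver \<phi>"
proof -
  obtain k where k: "n = Suc (Suc k)"
    using n by (metis add_2_eq_Suc le_Suc_ex)
  have iter: "\<phi> (((\<lambda>x. x - star x) ^^ k) (star_bracket A B))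
      = ((\<lambda>x. x - star x) ^^ k) (star_bracket (\<phi> A) (\<phi> B))" for A B
    using p[of A B] unfolding k p_star_identity_tail .
  have skew: "\<phi> (x - star x) = \<phi> x - star (\<phi> x)" for x
  proof -
    have "scaleC (2 ^ k) (\<phi> (x - star x)) = scaleC (2 ^ k) (\<phi> x - star (\<phi> x))"
      using iter[of x 1] by (simp add: one star_bracket_one skew_part_funpow hom)
    then show ?thesis
      by (rule scaleC_cancel[rotated]) simp
  qed
  have star_fix: "star (\<phi> b) = \<phi> b" if b: "star b = b" for b
  proof -
    \<comment> \<open>Since \<open>ib\<close> is skew, \<open>ib - (ib)\<^sup>* = 2ib\<close>.\<close>
    have "scaleC \<i> (scaleC 2 (\<phi> b)) = scaleC \<i> (\<phi> b + star (\<phi> b))"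
      using skew[of "scaleC \<i> b"] b
      by (simp add: star_simps hom scaleC_minus_left flip: scaleC_add_right scaleC_two)
        (simp add: scaleC_scaleC mult.commute)
    then have "\<phi> b + \<phi> b = \<phi> b + star (\<phi> b)"
      unfolding scaleC_two by (rule scaleC_cancel[rotated]) simp
    then show ?thesis
      by simp
  qed
  show ?thesis
  proof
    fix b x :: 'a
    assume b: "star b = b"
    have "star_bracket x b = x * b - star (x * b)"
      "star_bracket (\<phi> x) (\<phi> b) = \<phi> x * \<phi> b - star (\<phi> x * \<phi> b)"
      using b star_fix[OF b] by (simp_all add: star_bracket_def star_mult)
    then have "scaleC (2 ^ k) (\<phi> (star_bracket x b)) = scaleC (2 ^ k) (star_bracket (\<phi> x) (\<phi> b))"
      using iter[of x b] by (simp add: skew_part_funpow hom)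
    then show "\<phi> (star_bracket x b) = star_bracket (\<phi> x) (\<phi> b)"
      by (rule scaleC_cancel[rotated]) simp
  qed (fact hom skew)+
qed

theorem theorem2p2:
  fixes n :: nat
    and P1 P2 :: "'a::unital_cstar_algebra"
    and \<phi> :: "'a \<Rightarrow> 'b::unital_cstar_algebra"
  assumes "n \<ge> 2"
    and "nontrivial_symmetric_projection P1"
    and "P2 = 1 - P1"
    and "nontrivial_symmetric_projection P2"
    and "\<And>P X. P \<in> {P1, P2} \<Longrightarrow> {P * A * X | A. A \<in> UNIV} = {0} \<Longrightarrow> X = 0"
    and "bij \<phi>"
    and "\<phi> 1 = 1"
    and "\<And>c A. \<phi> (scaleC c A) = scaleC c (\<phi> A)"
    and "\<And>P Y. P \<in> {P1, P2} \<Longrightarrow> {\<phi> P * B * Y | B. B \<in> UNIV} = {0} \<Longrightarrow> Y = 0"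
    and "\<And>A B \<Xi>. \<Xi> \<in> {P1, P2, 1} \<Longrightarrow>
           \<phi> (p_star n ((\<lambda>_. \<Xi>)(1 := A, 2 := B)))
             = p_star n ((\<lambda>_. \<phi> \<Xi>)(1 := \<phi> A, 2 := \<phi> B))"
  shows "star_isomorphism \<phi>"
proof -
  have p: "\<phi> (p_star n ((\<lambda>_. 1)(1 := A, 2 := B)))
      = p_star n ((\<lambda>_. 1)(1 := \<phi> A, 2 := \<phi> B))" for A B
    using assms(10)[of 1 A B] assms(7) by simp
  interpret skew_bracket_preserver \<phi>
    by (rule skew_bracket_preserver_if_p_star[OF assms(1,7,8) p])
  have P1: "P1 * P1 = P1" "star P1 = P1" and P2: "P2 * P2 = P2" "star P2 = P2"
    using assms(2,4)
    by (simp_all add: nontrivial_symmetric_projection_def symmetric_projection_def power2_eq_square)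
  have faithful: "X = 0" if "P \<in> {P1, P2}" "\<And>A. P * A * X = 0" for P X
  proof -
    have "{P * A * X | A. A \<in> UNIV} = {0}"
      using that(2) by auto
    then show ?thesis
      by (rule assms(5)[OF that(1)])
  qed
  interpret peirce_skew_bracket_preserver \<phi> P1 P2
  proof
    show "P1 * P2 = 0" "P2 * P1 = 0" "P1 + P2 = 1"
      using P1 by (simp_all add: assms(3) algebra_simps)
  qed (use assms(6,7) P1 P2 faithful in blast)+
  show ?thesis
    by (rule star_isomorphism)
qed

end
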